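(* Let $(J_n)_{n\ge 0}$ and $(JL_n)_{n\ge 0}$ be the Jacobsthal and Jacobsthal-Lucas numbers, and for $n\ge 0$ let $$HSJ_n=\begin{bmatrix} J_n+jJ_{n+3}\\ -J_{n+1}+jJ_{n+2}\end{bmatrix},\qquad HSJL_n=\begin{bmatrix} JL_n+jJL_{n+3}\\ -JL_{n+1}+jJL_{n+2}\end{bmatrix}.$$ Then for all $n\ge 1$, $$JL_n\,HSJ_n+2\,JL_{n-1}\,HSJ_{n-1}=HSJL_{2n-1},$$ where $JL_n\,HSJ_n$ denotes the spinor $HSJ_n$ multiplied by the real scalar $JL_n$.
   Context: The Jacobsthal numbers: $J_0=0$, $J_1=1$, $J_{n+2}=J_{n+1}+2J_n$. The Jacobsthal-Lucas numbers: $JL_0=2$, $JL_1=1$, $JL_{n+2}=JL_{n+1}+2JL_n$. Here $j$ is the hyperbolic unit ($j^2=1$, $j\neq\pm1$); spinors are column vectors with two hyperbolic-number entries, added and multiplied by real scalars componentwise. *)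

theory Defs
  imports "HOL-Analysis.Cartesian_Space"
begin

fun jacobsthal :: "nat \<Rightarrow> nat" where
  "jacobsthal 0 = 0"
| "jacobsthal (Suc 0) = 1"
| "jacobsthal (Suc (Suc n)) = jacobsthal (Suc n) + 2 * jacobsthal n"

fun jacobsthal_lucas :: "nat \<Rightarrow> nat" where
  "jacobsthal_lucas 0 = 2"
| "jacobsthal_lucas (Suc 0) = 1"
| "jacobsthal_lucas (Suc (Suc n)) = jacobsthal_lucas (Suc n) + 2 * jacobsthal_lucas n"

text \<open>\<open>Hyperbolic a b\<close> is the hyperbolic (split-complex) number \<open>a + j b\<close>.\<close>

datatype hyperbolic = Hyperbolic (hre: real) (him: real)

lemma hyperbolic_eq_iff: "x = y \<longleftrightarrow> hre x = hre y \<and> him x = him y"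
  by (cases x; cases y) simp

instantiation hyperbolic :: real_algebra_1
begin

definition zero_hyperbolic where "0 = Hyperbolic 0 0"
definition one_hyperbolic where "1 = Hyperbolic 1 0"
definition plus_hyperbolic where
  "x + y = Hyperbolic (hre x + hre y) (him x + him y)"
definition uminus_hyperbolic where "- x = Hyperbolic (- hre x) (- him x)"
definition minus_hyperbolic where
  "x - y = Hyperbolic (hre x - hre y) (him x - him y)"
definition times_hyperbolic where
  "x * y = Hyperbolic (hre x * hre y + him x * him y) (hre x * him y + him x * hre y)"
definition scaleR_hyperbolic where
  "r *\<^sub>R x = Hyperbolic (r * hre x) (r * him x)"

lemmas hyperbolic_defs = zero_hyperbolic_def one_hyperbolic_def plus_hyperbolic_def
  uminus_hyperbolic_def minus_hyperbolic_def times_hyperbolic_def scaleR_hyperbolic_def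

instance
  by standard (simp_all add: hyperbolic_defs hyperbolic_eq_iff algebra_simps)

end

instance hyperbolic :: comm_ring_1
  by standard (simp_all add: hyperbolic_defs hyperbolic_eq_iff algebra_simps)

definition hyp_j :: hyperbolic where
  "hyp_j = Hyperbolic 0 1"

lemma hyp_j_square: "hyp_j ^ 2 = 1"
  by (simp add: hyp_j_def power2_eq_square hyperbolic_defs)

lemma hyp_j_neq: "hyp_j \<noteq> 1" "hyp_j \<noteq> - 1"
  by (simp_all add: hyp_j_def hyperbolic_defs)

lemma Hyperbolic_eq: "Hyperbolic a b = of_real a + hyp_j * of_real b"
  by (simp add: hyp_j_def of_real_def hyperbolic_defs)

type_synonym hyp_spinor = "hyperbolic ^ 2"

definition HSJ :: "nat \<Rightarrow> hyp_spinor" where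
  "HSJ n = vector
    [of_nat (jacobsthal n) + hyp_j * of_nat (jacobsthal (n + 3)),
     - of_nat (jacobsthal (n + 1)) + hyp_j * of_nat (jacobsthal (n + 2))]"

definition HSJL :: "nat \<Rightarrow> hyp_spinor" where
  "HSJL n = vector
    [of_nat (jacobsthal_lucas n) + hyp_j * of_nat (jacobsthal_lucas (n + 3)),
     - of_nat (jacobsthal_lucas (n + 1)) + hyp_j * of_nat (jacobsthal_lucas (n + 2))]"

end

(* A window u 0, ..., u 3 of a sequence determines a spinor linearly in u, and HSJ n and HSJL n are
   the spinors of the Jacobsthal and Jacobsthal-Lucas sequences shifted by n. Hence the addition
   formula JL (m + k + 1) = JL (m + 1) J (k + 1) + 2 JL m J k lifts entrywise to spinors, and the
   theorem is its diagonal case m = k = n - 1. *)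

theory Submission
  imports Defs
begin

lemma jacobsthal_recurrence_add:
  fixes u :: "nat \<Rightarrow> 'a::semiring_1"
  assumes recurrence: "\<And>n. u (Suc (Suc n)) = u (Suc n) + 2 * u n"
  shows "u (Suc (m + k)) = of_nat (jacobsthal (Suc k)) * u (Suc m) + 2 * of_nat (jacobsthal k) * u m"
proof (induction k arbitrary: m)
  case 0
  show ?case by simp
next
  case (Suc k)
  let ?a = "of_nat (jacobsthal (Suc k)) :: 'a" and ?b = "of_nat (jacobsthal k) :: 'a"
  have "u (Suc (m + Suc k)) = ?a * u (Suc (Suc m)) + 2 * ?b * u (Suc m)"
    using Suc.IH[of "Suc m"] by simp
  also have "\<dots> = (?a + 2 * ?b) * u (Suc m) + 2 * ?a * u m"
    by (simp add: recurrence algebra_simps mult_2)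
  also have "?a + 2 * ?b = of_nat (jacobsthal (Suc (Suc k)))"
    by simp
  finally show ?case .
qed

definition sequence_spinor :: "(nat \<Rightarrow> real) \<Rightarrow> hyp_spinor" where
  "sequence_spinor u =
    vector [of_real (u 0) + hyp_j * of_real (u 3), - of_real (u 1) + hyp_j * of_real (u 2)]"

lemma sequence_spinor_add:
  "sequence_spinor (\<lambda>i. u i + v i) = sequence_spinor u + sequence_spinor v"
  by (simp add: sequence_spinor_def vec_eq_iff forall_2 algebra_simps)

lemma sequence_spinor_scaleR:
  "sequence_spinor (\<lambda>i. c * u i) = c *\<^sub>R sequence_spinor u"
  by (simp add: sequence_spinor_def vec_eq_iff forall_2 scaleR_conv_of_real[where 'a = hyperbolic]
      algebra_simps)

lemma HSJ_eq_sequence_spinor: "HSJ n = sequence_spinor (\<lambda>i. real (jacobsthal (n + i)))"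
  by (simp add: HSJ_def sequence_spinor_def del: jacobsthal.simps)

lemma HSJL_eq_sequence_spinor: "HSJL n = sequence_spinor (\<lambda>i. real (jacobsthal_lucas (n + i)))"
  by (simp add: HSJL_def sequence_spinor_def del: jacobsthal_lucas.simps)

lemma HSJL_add:
  "HSJL (Suc (m + k))
     = real (jacobsthal_lucas (Suc m)) *\<^sub>R HSJ (Suc k) + (2 * real (jacobsthal_lucas m)) *\<^sub>R HSJ k"
proof -
  have "real (jacobsthal_lucas (Suc (m + k) + i))
      = real (jacobsthal_lucas (Suc m)) * real (jacobsthal (Suc k + i))
        + 2 * real (jacobsthal_lucas m) * real (jacobsthal (k + i))" for i
    using jacobsthal_recurrence_add[of "\<lambda>n. real (jacobsthal_lucas n)" m "k + i"]
    by (simp add: ac_simps)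
  then show ?thesis
    by (simp only: HSJL_eq_sequence_spinor HSJ_eq_sequence_spinor
        sequence_spinor_add sequence_spinor_scaleR)
qed

theorem theorem3p14:
  fixes n :: nat
  assumes "n \<ge> 1"
  shows "real (jacobsthal_lucas n) *\<^sub>R HSJ n
           + (2 * real (jacobsthal_lucas (n - 1))) *\<^sub>R HSJ (n - 1)
         = HSJL (2 * n - 1)"
proof -
  have "Suc (n - 1) = n" and "Suc (n - 1 + (n - 1)) = 2 * n - 1"
    using assms by simp_all
  then show ?thesis
    using HSJL_add[of "n - 1" "n - 1"] by (simp only:)
qed

end
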